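(* Let $M_1=(S_1,r_1)$ and $M_2=(S_2,r_2)$ be matroids and let $\alpha:\mathcal{F}(M_1)\to\mathcal{F}(M_2)$ be a lattice isomorphism satisfying $|\alpha(F)|=|F|$ for all $F\in\mathcal{F}(M_1)$. Then $M_1\cong M_2$.
   Context: Matroids are on finite ground sets, given by rank functions. The closure of $A\subseteq S$ in a matroid $(S,r)$ is $\mathrm{cl}(A)=\{s\in S:r(A\cup\{s\})=r(A)\}$, and a flat is a set $F$ with $\mathrm{cl}(F)=F$. $\mathcal{F}(M)$ is the lattice of flats ordered by inclusion (meet $\cap$, join $\mathrm{cl}(F_1\cup F_2)$). $M_1\cong M_2$ means there is a bijection $\beta:S_1\to S_2$ with $r_2(\beta(A))=r_1(A)$ for all $A\subseteq S_1$. *)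

theory Defs
  imports Main
begin

text \<open>A matroid on the finite ground set \<open>S\<close>, given by its rank function. Only the values of
  \<open>r\<close> on subsets of \<open>S\<close> are constrained.\<close>

locale matroid =
  fixes S :: "'a set" and r :: "'a set \<Rightarrow> nat"
  assumes finite_ground: "finite S"
    and rank_le_card: "A \<subseteq> S \<Longrightarrow> r A \<le> card A"
    and rank_mono: "A \<subseteq> B \<Longrightarrow> B \<subseteq> S \<Longrightarrow> r A \<le> r B"
    and rank_submodular:
      "A \<subseteq> S \<Longrightarrow> B \<subseteq> S \<Longrightarrow> r (A \<union> B) + r (A \<inter> B) \<le> r A + r B"

definition cl :: "'a set \<Rightarrow> ('a set \<Rightarrow> nat) \<Rightarrow> 'a set \<Rightarrow> 'a set" where
  "cl S r A = {s \<in> S. r (A \<union> {s}) = r A}"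

definition flats :: "'a set \<Rightarrow> ('a set \<Rightarrow> nat) \<Rightarrow> 'a set set" where
  "flats S r = {F. F \<subseteq> S \<and> cl S r F = F}"

definition flat_meet :: "'a set \<Rightarrow> 'a set \<Rightarrow> 'a set" where
  "flat_meet F G = F \<inter> G"

definition flat_join :: "'a set \<Rightarrow> ('a set \<Rightarrow> nat) \<Rightarrow> 'a set \<Rightarrow> 'a set \<Rightarrow> 'a set" where
  "flat_join S r F G = cl S r (F \<union> G)"

definition flat_lattice_iso ::
  "'a set \<Rightarrow> ('a set \<Rightarrow> nat) \<Rightarrow> 'b set \<Rightarrow> ('b set \<Rightarrow> nat) \<Rightarrow> ('a set \<Rightarrow> 'b set) \<Rightarrow> bool" where
  "flat_lattice_iso S1 r1 S2 r2 \<alpha> \<longleftrightarrow>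
     bij_betw \<alpha> (flats S1 r1) (flats S2 r2) \<and>
     (\<forall>F \<in> flats S1 r1. \<forall>G \<in> flats S1 r1.
        \<alpha> (flat_meet F G) = flat_meet (\<alpha> F) (\<alpha> G) \<and>
        \<alpha> (flat_join S1 r1 F G) = flat_join S2 r2 (\<alpha> F) (\<alpha> G))"

definition matroid_isomorphic ::
  "'a set \<Rightarrow> ('a set \<Rightarrow> nat) \<Rightarrow> 'b set \<Rightarrow> ('b set \<Rightarrow> nat) \<Rightarrow> bool" where
  "matroid_isomorphic S1 r1 S2 r2 \<longleftrightarrow>
     (\<exists>\<beta>. bij_betw \<beta> S1 S2 \<and> (\<forall>A \<subseteq> S1. r2 (\<beta> ` A) = r1 A))"

end

theory Submission
  imports Defs
begin

text \<open>Sort the elements \<open>s\<close> of the ground set by the flat \<open>cl {s}\<close>. A flat \<open>F\<close> is the disjoint union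
  of the classes of the flats below it, so by induction the cardinalities of the flats
  determine the sizes of all classes (loops and parallel classes alike), and \<open>\<alpha>\<close> preserves them.
  Gluing bijections between corresponding classes gives \<open>\<beta>\<close> with \<open>cl {\<beta> s} = \<alpha> (cl {s})\<close>, whence
  \<open>\<beta> s \<in> \<alpha> F \<longleftrightarrow> s \<in> F\<close> for every flat \<open>F\<close>. Thus \<open>\<beta>\<close> respects closure, and adding an element \<open>s\<close> to
  a set raises its rank by one exactly if \<open>s\<close> is not in the closure, so \<open>\<beta>\<close> respects rank.\<close>

context matroid
begin

lemma cl_subset: "cl S r A \<subseteq> S"
  by (auto simp: cl_def)

lemma finite_flats: "finite (flats S r)"
  using finite_ground by (auto simp: flats_def)

lemma cl_extensive:
  assumes "A \<subseteq> S"
  shows "A \<subseteq> cl S r A"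
  using assms by (auto simp: cl_def insert_absorb)

text \<open>Submodularity for \<open>A \<union> {s}\<close> and \<open>B\<close>, whose intersection
  contains \<open>A\<close>: the gain in rank from adding \<open>s\<close> to \<open>B\<close> is at
  most the gain from adding it to \<open>A\<close>.\<close>

lemma cl_mono:
  assumes "A \<subseteq> B" "B \<subseteq> S"
  shows "cl S r A \<subseteq> cl S r B"
proof
  fix s assume s: "s \<in> cl S r A"
  then have "s \<in> S" and eq: "r (A \<union> {s}) = r A" by (auto simp: cl_def)
  then have "r ((A \<union> {s}) \<union> B) + r ((A \<union> {s}) \<inter> B) \<le> r (A \<union> {s}) + r B"
    using assms by (intro rank_submodular) auto
  moreover have "r A \<le> r ((A \<union> {s}) \<inter> B)"
    using assms by (intro rank_mono) auto
  moreover have "(A \<union> {s}) \<union> B = B \<union> {s}" using assms by auto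
  moreover have "r B \<le> r (B \<union> {s})"
    using assms \<open>s \<in> S\<close> by (intro rank_mono) auto
  ultimately show "s \<in> cl S r B"
    using eq \<open>s \<in> S\<close> by (auto simp: cl_def)
qed

text \<open>Elements of the closure are added to \<open>A\<close> one at a time; by
  \<open>cl_mono\<close> each still lies in the closure of the enlarged set, so the rank never
  moves.\<close>

lemma rank_cl:
  assumes "A \<subseteq> S"
  shows "r (cl S r A) = r A"
proof -
  have "r (A \<union> T) = r A" if "finite T" "T \<subseteq> cl S r A" for T
    using that
  proof (induction T)
    case (insert t T)
    then have "t \<in> cl S r (A \<union> T)"
      using cl_mono[of A "A \<union> T"] assms cl_subset[of A] by auto
    with insert show ?case by (simp add: cl_def)
  qed simp
  moreover have "finite (cl S r A)"
    using cl_subset finite_ground by (rule finite_subset)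
  moreover have "A \<union> cl S r A = cl S r A"
    using cl_extensive[OF assms] by auto
  ultimately show ?thesis by fastforce
qed

lemma cl_in_flats:
  assumes "A \<subseteq> S"
  shows "cl S r A \<in> flats S r"
proof -
  have "cl S r (cl S r A) \<subseteq> cl S r A"
  proof
    fix s assume "s \<in> cl S r (cl S r A)"
    then have "s \<in> S" and "r (cl S r A \<union> {s}) = r A"
      using rank_cl[OF assms] by (auto simp: cl_def)
    moreover have "r (A \<union> {s}) \<le> r (cl S r A \<union> {s})"
      using cl_extensive[OF assms] cl_subset[of A] \<open>s \<in> S\<close> by (intro rank_mono) auto
    moreover have "r A \<le> r (A \<union> {s})"
      using assms \<open>s \<in> S\<close> by (intro rank_mono) auto
    ultimately show "s \<in> cl S r A" by (auto simp: cl_def)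
  qed
  with cl_extensive[OF cl_subset, of A] cl_subset[of A] show ?thesis
    by (auto simp: flats_def)
qed

lemma cl_subset_flat_iff:
  assumes "A \<subseteq> S" "F \<in> flats S r"
  shows "cl S r A \<subseteq> F \<longleftrightarrow> A \<subseteq> F"
  using cl_extensive[OF assms(1)] cl_mono[of A F] assms(2) by (auto simp: flats_def)

lemma inter_in_flats:
  assumes "F \<in> flats S r" "G \<in> flats S r"
  shows "F \<inter> G \<in> flats S r"
proof -
  have "F \<inter> G \<subseteq> S" using assms by (auto simp: flats_def)
  then have "cl S r (F \<inter> G) \<subseteq> F \<inter> G"
    using cl_subset_flat_iff assms by simp
  with cl_extensive \<open>F \<inter> G \<subseteq> S\<close> have "cl S r (F \<inter> G) = F \<inter> G" by blast
  with \<open>F \<inter> G \<subseteq> S\<close> show ?thesis by (simp add: flats_def)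
qed

text \<open>Expresses closure through flats alone, the form in which a map between flats can
  transport it. From right to left, take \<open>F\<close> to be \<open>cl S r A\<close>.\<close>

lemma mem_cl_iff_flats:
  assumes "A \<subseteq> S" "s \<in> S"
  shows "s \<in> cl S r A \<longleftrightarrow> (\<forall>F \<in> flats S r. A \<subseteq> F \<longrightarrow> s \<in> F)"
  using cl_subset_flat_iff[OF assms(1)] cl_in_flats[OF assms(1)] cl_extensive[OF assms(1)] by blast

text \<open>Submodularity for \<open>A\<close> and \<open>{s}\<close> bounds the gain by
  \<open>r {s}\<close>, hence by 1.\<close>

lemma rank_insert:
  assumes "A \<subseteq> S" "s \<in> S"
  shows "r (insert s A) = (if s \<in> cl S r A then r A else Suc (r A))"
proof -
  have "r (A \<union> {s}) + r (A \<inter> {s}) \<le> r A + r {s}"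
    using assms by (intro rank_submodular) auto
  moreover have "r {s} \<le> 1" using rank_le_card[of "{s}"] assms by simp
  moreover have "r A \<le> r (A \<union> {s})" using assms by (intro rank_mono) auto
  ultimately show ?thesis using assms by (auto simp: cl_def)
qed

text \<open>Holds because \<open>s \<in> F\<close> iff \<open>cl S r {s} \<subseteq> F\<close>. The
  fibre over \<open>cl S r {}\<close> consists of the loops; flats of rank at least 2 have empty
  fibres and contribute 0.\<close>

lemma card_flat:
  assumes "F \<in> flats S r"
  shows "card F = (\<Sum>G | G \<in> flats S r \<and> G \<subseteq> F. card {s \<in> S. cl S r {s} = G})"
proof -
  have F: "F = (\<Union>G\<in>{G \<in> flats S r. G \<subseteq> F}. {s \<in> S. cl S r {s} = G})"
    (is "F = ?U")
  proof -
    have "F \<subseteq> S" using assms by (simp add: flats_def)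
    moreover have "cl S r {s} \<subseteq> F \<longleftrightarrow> s \<in> F" "cl S r {s} \<in> flats S r" if "s \<in> S" for s
      using cl_subset_flat_iff[OF _ assms, of "{s}"] cl_in_flats[of "{s}"] that by auto
    ultimately show ?thesis by blast
  qed
  have "card ?U = (\<Sum>G | G \<in> flats S r \<and> G \<subseteq> F. card {s \<in> S. cl S r {s} = G})"
    using finite_ground finite_flats by (intro card_UN_disjoint) auto
  \<comment> \<open>\<open>F\<close> occurs in its own expansion \<open>?U\<close>, so it is
    replaced just once, under \<open>card\<close>, rather than used as a rewrite rule.\<close>
  with F show ?thesis by (rule trans[OF arg_cong])
qed

end

text \<open>Bijections between the fibres over \<open>x\<close> and \<open>h x\<close> are glued.
  Injectivity of \<open>h\<close> keeps different fibres apart, and \<open>g\<close> B \<subseteq> h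
  \<open>X\<close> makes the result surjective.\<close>

lemma bij_betw_from_fibres:
  assumes fin: "finite A" "finite B"
    and f: "f ` A \<subseteq> X" and g: "g ` B \<subseteq> h ` X" and inj: "inj_on h X"
    and card: "\<And>x. x \<in> X \<Longrightarrow> card {a \<in> A. f a = x} = card {b \<in> B. g b = h x}"
  obtains \<beta> where "bij_betw \<beta> A B" "\<And>a. a \<in> A \<Longrightarrow> g (\<beta> a) = h (f a)"
proof -
  have "\<exists>b. bij_betw b {a \<in> A. f a = x} {b \<in> B. g b = h x}" if "x \<in> X" for x
    using card[OF that] fin by (intro finite_same_card_bij) auto
  then obtain b where b: "\<And>x. x \<in> X \<Longrightarrow> bij_betw (b x) {a \<in> A. f a = x} {b \<in> B. g b = h x}"
    by metis
  define \<beta> where "\<beta> a = b (f a) a" for a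
  have \<beta>: "\<beta> a \<in> B" "g (\<beta> a) = h (f a)" if "a \<in> A" for a
    using b[of "f a"] f that by (auto simp: \<beta>_def dest: bij_betwE)
  have "inj_on \<beta> A"
  proof (rule inj_onI)
    fix a a' assume a: "a \<in> A" "a' \<in> A" "\<beta> a = \<beta> a'"
    then have "f a = f a'" using \<beta>(2) f inj by (metis image_subset_iff inj_onD)
    with a b[of "f a"] f show "a = a'"
      by (auto simp: \<beta>_def bij_betw_def inj_on_def)
  qed
  moreover have "B \<subseteq> \<beta> ` A"
  proof
    fix y assume y: "y \<in> B"
    then obtain x where x: "x \<in> X" "g y = h x" using g by auto
    then have "y \<in> b x ` {a \<in> A. f a = x}" using b[of x] y by (auto simp: bij_betw_def)
    then show "y \<in> \<beta> ` A" by (auto simp: \<beta>_def)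
  qed
  ultimately have "bij_betw \<beta> A B" using \<beta>(1) by (auto simp: bij_betw_def)
  with \<beta>(2) show thesis using that by blast
qed

text \<open>Inclusion is the equation \<open>F \<inter> G = F\<close>, which an injective map
  preserving meets both preserves and reflects.\<close>

lemma flat_lattice_iso_subset_iff:
  assumes "matroid S1 r1" "flat_lattice_iso S1 r1 S2 r2 \<alpha>" "F \<in> flats S1 r1" "G \<in> flats S1 r1"
  shows "\<alpha> F \<subseteq> \<alpha> G \<longleftrightarrow> F \<subseteq> G"
proof -
  have "F \<inter> G \<in> flats S1 r1" using matroid.inter_in_flats assms by blast
  moreover have "inj_on \<alpha> (flats S1 r1)"
    using assms(2) by (simp add: flat_lattice_iso_def bij_betw_def)
  ultimately have "\<alpha> (F \<inter> G) = \<alpha> F \<longleftrightarrow> F \<inter> G = F"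
    using assms(3) by (simp add: inj_on_eq_iff)
  moreover have "\<alpha> (F \<inter> G) = \<alpha> F \<inter> \<alpha> G"
    using assms(2-4) by (simp add: flat_lattice_iso_def flat_meet_def)
  ultimately show ?thesis by blast
qed

text \<open>Expand \<open>card F\<close> and \<open>card (\<alpha> F)\<close> by
  \<open>card_flat\<close>. The totals agree, and so do the terms of the proper subflats by
  induction; hence the top terms agree.\<close>

lemma card_fibre_flat_lattice_iso:
  assumes M1: "matroid S1 r1" and M2: "matroid S2 r2" and iso: "flat_lattice_iso S1 r1 S2 r2 \<alpha>"
    and card: "\<And>F. F \<in> flats S1 r1 \<Longrightarrow> card (\<alpha> F) = card F"
    and "F \<in> flats S1 r1"
  shows "card {s \<in> S1. cl S1 r1 {s} = F} = card {s \<in> S2. cl S2 r2 {s} = \<alpha> F}"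
  using assms(5)
proof (induction "card F" arbitrary: F rule: less_induct)
  case less
  let ?n1 = "\<lambda>G. card {s \<in> S1. cl S1 r1 {s} = G}" and ?n2 = "\<lambda>G. card {s \<in> S2. cl S2 r2 {s} = G}"
  have bij: "bij_betw \<alpha> (flats S1 r1) (flats S2 r2)"
    using iso by (simp add: flat_lattice_iso_def)
  define D where "D = {G \<in> flats S1 r1. G \<subset> F}"
  have D: "D \<subseteq> flats S1 r1" "F \<notin> D" by (auto simp: D_def)
  have finD: "finite D" using matroid.finite_flats[OF M1] by (simp add: D_def)
  have finF: "finite F"
    using less.prems matroid.finite_ground[OF M1] by (auto simp: flats_def intro: finite_subset)
  have inj: "inj_on \<alpha> (insert F D)"
    using D less.prems by (intro inj_on_subset[OF bij_betw_imp_inj_on[OF bij]]) simp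
  have below1: "{G \<in> flats S1 r1. G \<subseteq> F} = insert F D"
    using less.prems by (auto simp: D_def)
  have below2: "{H \<in> flats S2 r2. H \<subseteq> \<alpha> F} = \<alpha> ` insert F D"
    using flat_lattice_iso_subset_iff[OF M1 iso _ less.prems]
    unfolding bij_betw_imp_surj_on[OF bij, symmetric] below1[symmetric] by blast
  have "card F = (\<Sum>G\<in>insert F D. ?n1 G)"
    using matroid.card_flat[OF M1 less.prems] by (simp only: below1)
  moreover have "\<alpha> F \<in> flats S2 r2" using bij less.prems by (rule bij_betwE[rule_format])
  then have "card (\<alpha> F) = (\<Sum>H\<in>\<alpha> ` insert F D. ?n2 H)"
    using matroid.card_flat[OF M2] by (simp only: below2)
  then have "card (\<alpha> F) = (\<Sum>G\<in>insert F D. ?n2 (\<alpha> G))"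
    by (simp only: sum.reindex[OF inj] o_def)
  moreover have "(\<Sum>G\<in>D. ?n1 G) = (\<Sum>G\<in>D. ?n2 (\<alpha> G))"
    using less.hyps finF by (intro sum.cong) (auto simp: D_def psubset_card_mono)
  ultimately show ?case using card[OF less.prems] D finD by simp
qed

text \<open>Both ranks start at 0 on the empty set, and by \<open>rank_insert\<close> closure alone
  decides whether each new element adds 1.\<close>

lemma rank_image_eq:
  assumes M1: "matroid S1 r1" and M2: "matroid S2 r2" and \<beta>: "bij_betw \<beta> S1 S2"
    and cl: "\<And>A s. A \<subseteq> S1 \<Longrightarrow> s \<in> S1 \<Longrightarrow> \<beta> s \<in> cl S2 r2 (\<beta> ` A) \<longleftrightarrow> s \<in> cl S1 r1 A"
    and "A \<subseteq> S1"
  shows "r2 (\<beta> ` A) = r1 A"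
proof -
  have "finite A" using \<open>A \<subseteq> S1\<close> matroid.finite_ground[OF M1] by (rule finite_subset)
  then show ?thesis using \<open>A \<subseteq> S1\<close>
  proof (induction A)
    case empty
    show ?case
      using matroid.rank_le_card[OF M1, of "{}"] matroid.rank_le_card[OF M2, of "{}"] by simp
  next
    case (insert s A)
    moreover from this have "\<beta> ` A \<subseteq> S2" "\<beta> s \<in> S2"
      using bij_betw_imp_surj_on[OF \<beta>] by auto
    ultimately show ?case
      using matroid.rank_insert[OF M1, of A s] matroid.rank_insert[OF M2, of "\<beta> ` A" "\<beta> s"] cl[of A s]
      by simp
  qed
qed

theorem theorem6p4:
  fixes S1 :: "'a set" and r1 :: "'a set \<Rightarrow> nat"
    and S2 :: "'b set" and r2 :: "'b set \<Rightarrow> nat"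
    and \<alpha> :: "'a set \<Rightarrow> 'b set"
  assumes "matroid S1 r1"
    and "matroid S2 r2"
    and "flat_lattice_iso S1 r1 S2 r2 \<alpha>"
    and "\<And>F. F \<in> flats S1 r1 \<Longrightarrow> card (\<alpha> F) = card F"
  shows "matroid_isomorphic S1 r1 S2 r2"
proof -
  interpret M1: matroid S1 r1 by fact
  interpret M2: matroid S2 r2 by fact
  have surj: "\<alpha> ` flats S1 r1 = flats S2 r2" and inj: "inj_on \<alpha> (flats S1 r1)"
    using assms(3) by (auto simp: flat_lattice_iso_def bij_betw_def)
  have fib1: "(\<lambda>s. cl S1 r1 {s}) ` S1 \<subseteq> flats S1 r1"
    using M1.cl_in_flats by auto
  have fib2: "(\<lambda>s. cl S2 r2 {s}) ` S2 \<subseteq> \<alpha> ` flats S1 r1"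
    unfolding surj using M2.cl_in_flats by auto
  \<comment> \<open>The index set for the gluing is \<open>flats S1 r1\<close>, with
    \<open>h = \<alpha>\<close> and both fibrations sending \<open>s\<close> to the closure of
    \<open>{s}\<close>.\<close>
  obtain \<beta> where \<beta>: "bij_betw \<beta> S1 S2"
    and cl_\<beta>: "\<And>s. s \<in> S1 \<Longrightarrow> cl S2 r2 {\<beta> s} = \<alpha> (cl S1 r1 {s})"
    using bij_betw_from_fibres[OF M1.finite_ground M2.finite_ground fib1 fib2 inj
        card_fibre_flat_lattice_iso[OF assms]] by blast
  have \<beta>_mem: "\<beta> s \<in> S2" if "s \<in> S1" for s using \<beta> that by (auto dest: bij_betwE)
  have mem_iff: "\<beta> s \<in> \<alpha> F \<longleftrightarrow> s \<in> F" if "s \<in> S1" "F \<in> flats S1 r1" for s F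
  proof -
    have "\<beta> s \<in> \<alpha> F \<longleftrightarrow> cl S2 r2 {\<beta> s} \<subseteq> \<alpha> F"
      using M2.cl_subset_flat_iff[of "{\<beta> s}" "\<alpha> F"] \<beta>_mem that surj by auto
    also have "\<dots> \<longleftrightarrow> cl S1 r1 {s} \<subseteq> F"
      using flat_lattice_iso_subset_iff[OF assms(1,3)] M1.cl_in_flats that cl_\<beta> by simp
    also have "\<dots> \<longleftrightarrow> s \<in> F"
      using M1.cl_subset_flat_iff[of "{s}" F] that by simp
    finally show ?thesis .
  qed
  have "\<beta> s \<in> cl S2 r2 (\<beta> ` A) \<longleftrightarrow> s \<in> cl S1 r1 A" if "A \<subseteq> S1" "s \<in> S1" for A s
  proof -
    have "\<beta> ` A \<subseteq> \<alpha> F \<longleftrightarrow> A \<subseteq> F" if "F \<in> flats S1 r1" for F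
      using mem_iff[OF _ that] \<open>A \<subseteq> S1\<close> by blast
    moreover have "\<beta> ` A \<subseteq> S2" using \<beta>_mem that by auto
    ultimately show ?thesis
      using M1.mem_cl_iff_flats[OF that] M2.mem_cl_iff_flats[of "\<beta> ` A" "\<beta> s"] \<beta>_mem that mem_iff
      unfolding surj[symmetric] by simp
  qed
  then have "\<forall>A\<subseteq>S1. r2 (\<beta> ` A) = r1 A"
    using rank_image_eq[OF assms(1,2) \<beta>] by blast
  with \<beta> show ?thesis by (auto simp: matroid_isomorphic_def)
qed

end
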